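(* Consider the disjunctive constraint $\bigvee_{l\in\mathcal D}\big[\,g_k(\boldsymbol x)\le b_{l,k}\ \forall k\in\mathcal C_l,\ \boldsymbol x\in\mathcal X\,\big]$ with possibly several constraints per disjunct. The $1$-split formulation is equivalent to the big-M formulation, i.e. their continuous relaxations have the same projection onto the $\boldsymbol x$-space. Moreover, if the bounds on the split variables are additive, then further splitting one group of variables in a $P$-split formulation into two groups, to form a $(P+1)$-split formulation, results in an as tight or tighter continuous relaxation, i.e. the projection onto the $\boldsymbol x$-space of the continuous relaxation of the $(P+1)$-split formulation is contained in that of the $P$-split formulation.
   Context: Setting. $\mathcal X\subset\mathbb R^n$ is a convex compact set, $\mathcal D$ is a finite set of disjunct indices, $\mathcal C_l$ is the finite set of constraint indices in disjunct $l\in\mathcal D$, and $b_{l,k}\in\mathbb R$. Each $g_k(\boldsymbol x)=\sum_{i=1}^n h_{i,k}(x_i)$ with $h_{i,k}:\mathbb R\to\mathbb R$ convex; all $g_k$ are bounded on $\mathcal X$; each disjunct $\{\boldsymbol x\in\mathcal X: g_k(\boldsymbol x)\le b_{l,k}\ \forall k\in\mathcal C_l\}$ is non-empty. $P$-split formulation. Let $\mathcal I_1,\dots,\mathcal I_P$ be a partition of $\{1,\dots,n\}$ into $P$ pairwise disjoint non-empty sets (the variable groups). For $s\in\{1,\dots,P\}$, $l\in\mathcal D$, $k\in\mathcal C_l$ put $\underline{\alpha}^{l,k}_s=\min_{\boldsymbol x\in\mathcal X}\sum_{i\in\mathcal I_s}h_{i,k}(x_i)$ and $\bar\alpha^{l,k}_s=\max_{\boldsymbol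 x\in\mathcal X}\sum_{i\in\mathcal I_s}h_{i,k}(x_i)$. The $P$-split formulation has variables $\boldsymbol x\in\mathcal X$, $\alpha^{l,k}_s\in\mathbb R$, $\nu^{\alpha^{l,k}_s}_d\in\mathbb R$ ($d\in\mathcal D$), $\boldsymbol\lambda\in\{0,1\}^{|\mathcal D|}$ and constraints, for all $s\in\{1,\dots,P\}$, $l,d\in\mathcal D$, $k\in\mathcal C_l$: $$\alpha^{l,k}_s=\sum_{d'\in\mathcal D}\nu^{\alpha^{l,k}_s}_{d'},\quad \sum_{s'=1}^P\nu^{\alpha^{l,k}_{s'}}_l\le b_{l,k}\lambda_l,\quad \underline{\alpha}^{l,k}_s\lambda_d\le\nu^{\alpha^{l,k}_s}_d\le\bar\alpha^{l,k}_s\lambda_d,\quad \sum_{i\in\mathcal I_s}h_{i,k}(x_i)\le\alpha^{l,k}_s,\quad \sum_{l'\in\mathcal D}\lambda_{l'}=1.$$ Its continuous relaxation replaces $\boldsymbol\lambda\in\{0,1\}^{|\mathcal D|}$ by $\boldsymbol\lambda\in[0,1]^{|\mathcal D|}$. Big-M formulation. Variables $\boldsymbol x\in\mathcal X$, $\boldsymbol\lambda\in\{0,1\}^{|\mathcal D|}$ with $\sum_{l\in\mathcal D}\lambda_l=1$ and $\sum_{i=1}^n h_{i,k}(x_i)\le b_{l,k}+M^{l,k}(1-\lambda_l)$ for all $l\in\mathcal D$, $k\in\mathcal C_l$, where $M^{l,k}=\max_{\boldsymbol x\in\mathcal X}\sum_{i=1}^nh_{i,k}(x_i)-b_{l,k}$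 is the smallest valid coefficient over $\mathcal X$. Its continuous relaxation again uses $\boldsymbol\lambda\in[0,1]^{|\mathcal D|}$. Additive bounds. The bounds are additive over $\mathcal X$ if for every constraint function $g_k$ and all disjoint $\mathcal I,\mathcal I'\subset\{1,\dots,n\}$, $\min_{\boldsymbol x\in\mathcal X}\big(\sum_{i\in\mathcal I}h_{i,k}(x_i)+\sum_{i\in\mathcal I'}h_{i,k}(x_i)\big)=\min_{\boldsymbol x\in\mathcal X}\sum_{i\in\mathcal I}h_{i,k}(x_i)+\min_{\boldsymbol x\in\mathcal X}\sum_{i\in\mathcal I'}h_{i,k}(x_i)$, and the same identity holds with $\max$ in place of $\min$. *)

theory Defs
  imports "HOL-Analysis.Analysis"
begin

definition group_sum :: "('n \<Rightarrow> 'k \<Rightarrow> real \<Rightarrow> real) \<Rightarrow> 'k \<Rightarrow> 'n set \<Rightarrow> real ^ 'n \<Rightarrow> real"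
  where "group_sum h k S x = (\<Sum>i\<in>S. h i k (x $ i))"

definition constr_fun :: "('n \<Rightarrow> 'k \<Rightarrow> real \<Rightarrow> real) \<Rightarrow> 'k \<Rightarrow> real ^ 'n \<Rightarrow> real"
  where "constr_fun h k x = group_sum h k UNIV x"

text \<open>
  Minima and maxima over \<open>X\<close> are written as infima and suprema.  For non-empty compact \<open>X\<close> and
  convex \<open>h i k\<close> they are attained, see \<open>group_min_attained\<close> and \<open>group_max_attained\<close> below.
\<close>

definition group_min :: "(real ^ 'n) set \<Rightarrow> ('n \<Rightarrow> 'k \<Rightarrow> real \<Rightarrow> real) \<Rightarrow> 'k \<Rightarrow> 'n set \<Rightarrow> real"
  where "group_min X h k S = (INF x\<in>X. group_sum h k S x)"

definition group_max :: "(real ^ 'n) set \<Rightarrow> ('n \<Rightarrow> 'k \<Rightarrow> real \<Rightarrow> real) \<Rightarrow> 'k \<Rightarrow> 'n set \<Rightarrow> real"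
  where "group_max X h k S = (SUP x\<in>X. group_sum h k S x)"

lemma continuous_on_group_sum:
  fixes h :: "'n::finite \<Rightarrow> 'k \<Rightarrow> real \<Rightarrow> real"
  assumes "\<And>i. convex_on UNIV (h i k)"
  shows "continuous_on X (group_sum h k S)"
proof -
  have "continuous_on UNIV (h i k)" for i
    using assms by (intro convex_on_continuous) auto
  then have "continuous_on X (\<lambda>x::real ^ 'n. h i k (x $ i))" for i
    by (rule continuous_on_compose2) (auto intro!: continuous_intros)
  then show ?thesis
    unfolding group_sum_def by (intro continuous_on_sum)
qed

lemma group_min_attained:
  fixes h :: "'n::finite \<Rightarrow> 'k \<Rightarrow> real \<Rightarrow> real"
  assumes "compact X" "X \<noteq> {}" "\<And>i. convex_on UNIV (h i k)"
  shows "\<exists>x\<in>X. group_sum h k S x = group_min X h k S \<and> (\<forall>y\<in>X. group_min X h k S \<le> group_sum h k S y)"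
proof -
  obtain x where x: "x \<in> X" "\<forall>y\<in>X. group_sum h k S x \<le> group_sum h k S y"
    using continuous_attains_inf[OF assms(1,2) continuous_on_group_sum[where h = h and k = k, OF assms(3)]] by blast
  then have "group_min X h k S = group_sum h k S x"
    unfolding group_min_def by (intro cInf_eq_minimum) auto
  with x show ?thesis by auto
qed

lemma group_max_attained:
  fixes h :: "'n::finite \<Rightarrow> 'k \<Rightarrow> real \<Rightarrow> real"
  assumes "compact X" "X \<noteq> {}" "\<And>i. convex_on UNIV (h i k)"
  shows "\<exists>x\<in>X. group_sum h k S x = group_max X h k S \<and> (\<forall>y\<in>X. group_sum h k S y \<le> group_max X h k S)"
proof -
  obtain x where x: "x \<in> X" "\<forall>y\<in>X. group_sum h k S y \<le> group_sum h k S x"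
    using continuous_attains_sup[OF assms(1,2) continuous_on_group_sum[where h = h and k = k, OF assms(3)]] by blast
  then have "group_max X h k S = group_sum h k S x"
    unfolding group_max_def by (intro cSup_eq_maximum) auto
  with x show ?thesis by auto
qed

definition variable_groups :: "nat \<Rightarrow> (nat \<Rightarrow> 'n set) \<Rightarrow> bool"
  where "variable_groups P I \<longleftrightarrow>
    (\<forall>s\<in>{1..P}. I s \<noteq> {}) \<and> disjoint_family_on I {1..P} \<and> (\<Union>s\<in>{1..P}. I s) = UNIV"

text \<open>
  \<open>J\<close> arises from \<open>I\<close> by replacing one group with two.  The groups are compared as a family of sets,
  so the numbering of the \<open>P + 1\<close> new groups is immaterial.
\<close>

definition splits_one_group :: "nat \<Rightarrow> (nat \<Rightarrow> 'n set) \<Rightarrow> (nat \<Rightarrow> 'n set) \<Rightarrow> bool"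
  where "splits_one_group P I J \<longleftrightarrow>
    (\<exists>s\<in>{1..P}. \<exists>A B. A \<noteq> {} \<and> B \<noteq> {} \<and> A \<inter> B = {} \<and> A \<union> B = I s \<and>
       J ` {1..P + 1} = I ` ({1..P} - {s}) \<union> {A, B})"

text \<open>
  The formulations are sets of tuples of variables, over an admissible set \<open>L\<close> for each \<open>lam d\<close>:
  \<open>L = {0, 1}\<close> gives the mixed-integer formulation and \<open>L = {0..1}\<close> its continuous relaxation.
  The value \<open>\<nu> l k s d\<close> is the copy for disjunct \<open>d\<close> of the split variable \<open>\<alpha> l k s\<close>.
  Entries of \<open>\<alpha>\<close>, \<open>\<nu>\<close> and \<open>lam\<close> outside the index ranges are left free.
\<close>

definition p_split ::
  "(real ^ 'n) set \<Rightarrow> 'd set \<Rightarrow> ('d \<Rightarrow> 'k set) \<Rightarrow> ('n \<Rightarrow> 'k \<Rightarrow> real \<Rightarrow> real) \<Rightarrow> ('d \<Rightarrow> 'k \<Rightarrow> real) \<Rightarrow>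
   nat \<Rightarrow> (nat \<Rightarrow> 'n set) \<Rightarrow> real set \<Rightarrow>
   ((real ^ 'n) \<times> ('d \<Rightarrow> 'k \<Rightarrow> nat \<Rightarrow> real) \<times> ('d \<Rightarrow> 'k \<Rightarrow> nat \<Rightarrow> 'd \<Rightarrow> real) \<times> ('d \<Rightarrow> real)) set"
  where "p_split X D C h b P I L =
    {(x, \<alpha>, \<nu>, lam). x \<in> X \<and> (\<forall>d\<in>D. lam d \<in> L) \<and> (\<Sum>d\<in>D. lam d) = 1 \<and>
      (\<forall>l\<in>D. \<forall>k\<in>C l.
        (\<Sum>s=1..P. \<nu> l k s l) \<le> b l k * lam l \<and>
        (\<forall>s\<in>{1..P}.
          \<alpha> l k s = (\<Sum>d\<in>D. \<nu> l k s d) \<and>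
          (\<forall>d\<in>D. group_min X h k (I s) * lam d \<le> \<nu> l k s d \<and>
                  \<nu> l k s d \<le> group_max X h k (I s) * lam d) \<and>
          group_sum h k (I s) x \<le> \<alpha> l k s))}"

definition big_M_coeff ::
  "(real ^ 'n) set \<Rightarrow> ('n \<Rightarrow> 'k \<Rightarrow> real \<Rightarrow> real) \<Rightarrow> ('d \<Rightarrow> 'k \<Rightarrow> real) \<Rightarrow> 'd \<Rightarrow> 'k \<Rightarrow> real"
  where "big_M_coeff X h b l k = (SUP x\<in>X. constr_fun h k x) - b l k"

definition big_M ::
  "(real ^ 'n) set \<Rightarrow> 'd set \<Rightarrow> ('d \<Rightarrow> 'k set) \<Rightarrow> ('n \<Rightarrow> 'k \<Rightarrow> real \<Rightarrow> real) \<Rightarrow> ('d \<Rightarrow> 'k \<Rightarrow> real) \<Rightarrow>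
   real set \<Rightarrow> ((real ^ 'n) \<times> ('d \<Rightarrow> real)) set"
  where "big_M X D C h b L =
    {(x, lam). x \<in> X \<and> (\<forall>d\<in>D. lam d \<in> L) \<and> (\<Sum>d\<in>D. lam d) = 1 \<and>
      (\<forall>l\<in>D. \<forall>k\<in>C l. constr_fun h k x \<le> b l k + big_M_coeff X h b l k * (1 - lam l))}"

definition additive_bounds ::
  "(real ^ 'n) set \<Rightarrow> 'd set \<Rightarrow> ('d \<Rightarrow> 'k set) \<Rightarrow> ('n \<Rightarrow> 'k \<Rightarrow> real \<Rightarrow> real) \<Rightarrow> bool"
  where "additive_bounds X D C h \<longleftrightarrow>
    (\<forall>k\<in>(\<Union>l\<in>D. C l). \<forall>S T. S \<inter> T = {} \<longrightarrow>
      (INF x\<in>X. group_sum h k S x + group_sum h k T x) = group_min X h k S + group_min X h k T \<and>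
      (SUP x\<in>X. group_sum h k S x + group_sum h k T x) = group_max X h k S + group_max X h k T)"

end

theory Submission
  imports Defs
begin

text \<open>
  Both claims compare, for fixed \<open>x\<close> and \<open>lam\<close>, which values of the auxiliary variables \<open>\<alpha>\<close> and
  \<open>\<nu>\<close> are possible, so \<open>lam\<close> is never changed.

  With a single group, the constraints on \<open>\<nu>\<close> for one pair \<open>(l, k)\<close> can be eliminated exactly.  The
  only demand from below is that the copies add up to at least \<open>g\<^sub>k(x)\<close>, so each copy may be raised
  to its upper bound: the maximum of \<open>g\<^sub>k\<close> times \<open>lam d\<close> for \<open>d \<noteq> l\<close>, and the smaller of
  this maximum and \<open>b l k\<close>, times \<open>lam l\<close>, for \<open>d = l\<close>.  Feasibility of this choice is exactly the big-M inequality
  (\<open>largest_copies_iff_big_M\<close>); that the disjunct is non-empty ensures that lower and upper bound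
  of the \<open>l\<close>-th copy do not cross.

  For the second claim, a point of the finer formulation is sent to the coarser one by adding up the
  split variables of all fine groups inside a coarse group.  Every constraint of the coarse
  formulation is then a sum of constraints of the fine one, provided that the bounds of a coarse
  group are the sums of the bounds of its parts, which is what additivity yields
  (\<open>additive_bounds_Union\<close>).  This works for any refinement of the partition, of which
  splitting one group in two is a special case (\<open>p_split_refinement\<close>).
\<close>

section \<open>One group of variables\<close>

text \<open>
  This is one step of Fourier-Motzkin elimination: the copies \<open>\<nu>\<close> of one split variable with range
  \<open>{m..M}\<close> are projected out.  The hypothesis \<open>y \<le> M\<close> covers the case \<open>M < b\<close>, in which the
  bound \<open>b * lam l\<close> is weaker than \<open>M * lam l\<close>.
\<close>

lemma largest_copies_iff_big_M:
  fixes lam :: "'d \<Rightarrow> real"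
  assumes D: "finite D" "l \<in> D" and lam: "\<And>d. d \<in> D \<Longrightarrow> 0 \<le> lam d" "(\<Sum>d\<in>D. lam d) = 1"
    and bounds: "m \<le> b" "m \<le> M" "y \<le> M"
  shows "(\<exists>\<nu>. \<nu> l \<le> b * lam l \<and> (\<forall>d\<in>D. m * lam d \<le> \<nu> d \<and> \<nu> d \<le> M * lam d) \<and> y \<le> (\<Sum>d\<in>D. \<nu> d))
    \<longleftrightarrow> y \<le> b + (M - b) * (1 - lam l)"
proof -
  have rest: "(\<Sum>d\<in>D - {l}. M * lam d) = M * (1 - lam l)"
    using D lam(2) by (simp add: sum_distrib_left[symmetric] sum_diff1)
  have split: "(\<Sum>d\<in>D. \<nu> d) = \<nu> l + (\<Sum>d\<in>D - {l}. \<nu> d)" for \<nu> :: "'d \<Rightarrow> real"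
    using D by (simp add: sum.remove)
  have big_M: "b + (M - b) * (1 - lam l) = b * lam l + M * (1 - lam l)"
    by (simp add: algebra_simps)
  show ?thesis
  proof
    assume "\<exists>\<nu>. \<nu> l \<le> b * lam l \<and> (\<forall>d\<in>D. m * lam d \<le> \<nu> d \<and> \<nu> d \<le> M * lam d) \<and> y \<le> (\<Sum>d\<in>D. \<nu> d)"
    then obtain \<nu> where \<nu>: "\<nu> l \<le> b * lam l" "\<And>d. d \<in> D \<Longrightarrow> \<nu> d \<le> M * lam d" "y \<le> (\<Sum>d\<in>D. \<nu> d)"
      by blast
    have "(\<Sum>d\<in>D - {l}. \<nu> d) \<le> (\<Sum>d\<in>D - {l}. M * lam d)"
      using \<nu>(2) by (intro sum_mono) auto
    then show "y \<le> b + (M - b) * (1 - lam l)"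
      using \<nu>(1,3) unfolding big_M split[of \<nu>] rest by linarith
  next
    assume y: "y \<le> b + (M - b) * (1 - lam l)"
    define \<nu> where "\<nu> d = (if d = l then min b M else M) * lam d" for d
    have "\<nu> l \<le> b * lam l"
      using lam(1)[OF D(2)] by (simp add: \<nu>_def mult_right_mono)
    moreover have "m * lam d \<le> \<nu> d \<and> \<nu> d \<le> M * lam d" if "d \<in> D" for d
      using lam(1)[OF that] bounds by (simp add: \<nu>_def mult_right_mono)
    moreover have "(\<Sum>d\<in>D. \<nu> d) = min b M * lam l + M * (1 - lam l)"
      unfolding split[of \<nu>] rest[symmetric] by (simp add: \<nu>_def)
    then have "y \<le> (\<Sum>d\<in>D. \<nu> d)"
      using y bounds(3) unfolding big_M by (cases "b \<le> M") (auto simp: algebra_simps)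
    ultimately show "\<exists>\<nu>. \<nu> l \<le> b * lam l \<and> (\<forall>d\<in>D. m * lam d \<le> \<nu> d \<and> \<nu> d \<le> M * lam d) \<and> y \<le> (\<Sum>d\<in>D. \<nu> d)"
      by blast
  qed
qed

lemma one_split_projection_eq_big_M:
  fixes X :: "(real ^ 'n) set" and h :: "'n \<Rightarrow> 'k \<Rightarrow> real \<Rightarrow> real" and C :: "'d \<Rightarrow> 'k set"
  assumes "compact X" "finite D"
    and conv: "\<And>l k i. l \<in> D \<Longrightarrow> k \<in> C l \<Longrightarrow> convex_on UNIV (h i k)"
    and nonempty: "\<And>l. l \<in> D \<Longrightarrow> {x \<in> X. \<forall>k\<in>C l. constr_fun h k x \<le> b l k} \<noteq> {}"
    and I: "I 1 = UNIV"
  shows "fst ` p_split X D C h b 1 I {0..1} = fst ` big_M X D C h b {0..1}"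
proof -
  have constraint: "(\<exists>\<nu>. \<nu> l \<le> b l k * lam l \<and>
      (\<forall>d\<in>D. group_min X h k UNIV * lam d \<le> \<nu> d \<and> \<nu> d \<le> group_max X h k UNIV * lam d) \<and>
      group_sum h k UNIV x \<le> (\<Sum>d\<in>D. \<nu> d)) \<longleftrightarrow>
    constr_fun h k x \<le> b l k + big_M_coeff X h b l k * (1 - lam l)"
    if "x \<in> X" "\<forall>d\<in>D. lam d \<in> {0..1}" "(\<Sum>d\<in>D. lam d) = 1" "l \<in> D" "k \<in> C l" for x lam l k
  proof -
    have X: "X \<noteq> {}" using that(1) by blast
    have min: "group_min X h k UNIV \<le> group_sum h k UNIV y" if "y \<in> X" for y
      using group_min_attained[where h = h and k = k, OF assms(1) X conv[OF \<open>l \<in> D\<close> \<open>k \<in> C l\<close>]] that by blast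
    have max: "group_sum h k UNIV y \<le> group_max X h k UNIV" if "y \<in> X" for y
      using group_max_attained[where h = h and k = k, OF assms(1) X conv[OF \<open>l \<in> D\<close> \<open>k \<in> C l\<close>]] that by blast
    obtain z where "z \<in> X" "group_sum h k UNIV z \<le> b l k"
      using nonempty[OF \<open>l \<in> D\<close>] \<open>k \<in> C l\<close> by (auto simp: constr_fun_def)
    then have "group_min X h k UNIV \<le> b l k"
      using min by (meson order_trans)
    moreover have "group_min X h k UNIV \<le> group_max X h k UNIV"
      using min max that(1) by (meson order_trans)
    moreover have "big_M_coeff X h b l k = group_max X h k UNIV - b l k"
      by (simp add: big_M_coeff_def group_max_def constr_fun_def)
    moreover have "0 \<le> lam d" if "d \<in> D" for d
      using \<open>\<forall>d\<in>D. lam d \<in> {0..1}\<close> that by simp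
    ultimately show ?thesis
      using largest_copies_iff_big_M[of D l lam "group_min X h k UNIV" "b l k" "group_max X h k UNIV"
          "group_sum h k UNIV x", OF assms(2) that(4) _ that(3)] max[OF that(1)]
      by (simp add: constr_fun_def)
  qed
  have "(\<exists>\<alpha> \<nu>. (x, \<alpha>, \<nu>, lam) \<in> p_split X D C h b 1 I {0..1}) \<longleftrightarrow> (x, lam) \<in> big_M X D C h b {0..1}"
    for x lam
  proof
    assume "\<exists>\<alpha> \<nu>. (x, \<alpha>, \<nu>, lam) \<in> p_split X D C h b 1 I {0..1}"
    then obtain \<alpha> \<nu> where p: "(x, \<alpha>, \<nu>, lam) \<in> p_split X D C h b 1 I {0..1}" by blast
    then have lam: "x \<in> X" "\<forall>d\<in>D. lam d \<in> {0..1}" "(\<Sum>d\<in>D. lam d) = 1"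
      by (simp_all add: p_split_def)
    have "constr_fun h k x \<le> b l k + big_M_coeff X h b l k * (1 - lam l)"
      if "l \<in> D" "k \<in> C l" for l k
    proof -
      have "\<nu> l k 1 l \<le> b l k * lam l \<and> (\<forall>d\<in>D. group_min X h k UNIV * lam d \<le> \<nu> l k 1 d \<and>
          \<nu> l k 1 d \<le> group_max X h k UNIV * lam d) \<and> group_sum h k UNIV x \<le> (\<Sum>d\<in>D. \<nu> l k 1 d)"
        using p that I by (simp add: p_split_def) metis
      then show ?thesis
        using constraint[OF lam that] by blast
    qed
    with lam show "(x, lam) \<in> big_M X D C h b {0..1}"
      by (simp add: big_M_def)
  next
    assume p: "(x, lam) \<in> big_M X D C h b {0..1}"
    then have lam: "x \<in> X" "\<forall>d\<in>D. lam d \<in> {0..1}" "(\<Sum>d\<in>D. lam d) = 1"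
      by (simp_all add: big_M_def)
    have "\<forall>l k. \<exists>\<nu>. l \<in> D \<longrightarrow> k \<in> C l \<longrightarrow> \<nu> l \<le> b l k * lam l \<and>
        (\<forall>d\<in>D. group_min X h k UNIV * lam d \<le> \<nu> d \<and> \<nu> d \<le> group_max X h k UNIV * lam d) \<and>
        group_sum h k UNIV x \<le> (\<Sum>d\<in>D. \<nu> d)"
      using p constraint[OF lam] unfolding big_M_def by blast
    then obtain \<nu> where "\<And>l k. l \<in> D \<Longrightarrow> k \<in> C l \<Longrightarrow> \<nu> l k l \<le> b l k * lam l \<and>
        (\<forall>d\<in>D. group_min X h k UNIV * lam d \<le> \<nu> l k d \<and> \<nu> l k d \<le> group_max X h k UNIV * lam d) \<and>
        group_sum h k UNIV x \<le> (\<Sum>d\<in>D. \<nu> l k d)"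
      by metis
    then have "(x, \<lambda>l k s. \<Sum>d\<in>D. \<nu> l k d, \<lambda>l k s. \<nu> l k, lam) \<in> p_split X D C h b 1 I {0..1}"
      using lam I by (auto simp: p_split_def)
    then show "\<exists>\<alpha> \<nu>. (x, \<alpha>, \<nu>, lam) \<in> p_split X D C h b 1 I {0..1}"
      by blast
  qed
  then have "(\<exists>\<alpha> \<nu> lam. (x, \<alpha>, \<nu>, lam) \<in> p_split X D C h b 1 I {0..1}) \<longleftrightarrow>
      (\<exists>lam. (x, lam) \<in> big_M X D C h b {0..1})" for x
    by blast
  moreover have "x \<in> fst ` A \<longleftrightarrow> (\<exists>\<alpha> \<nu> lam. (x, \<alpha>, \<nu>, lam) \<in> A)" for x and
      A :: "((real ^ 'n) \<times> ('d \<Rightarrow> 'k \<Rightarrow> nat \<Rightarrow> real) \<times> ('d \<Rightarrow> 'k \<Rightarrow> nat \<Rightarrow> 'd \<Rightarrow> real) \<times> ('d \<Rightarrow> real)) set"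
    by force
  moreover have "x \<in> fst ` B \<longleftrightarrow> (\<exists>lam. (x, lam) \<in> B)" for x and B :: "((real ^ 'n) \<times> ('d \<Rightarrow> real)) set"
    by force
  ultimately show ?thesis
    by (intro set_eqI) (simp only:)
qed

section \<open>Refining the groups of variables\<close>

lemma group_sum_Union:
  fixes J :: "'t \<Rightarrow> 'n::finite set"
  assumes "finite T" "disjoint_family_on J T"
  shows "group_sum h k (\<Union>t\<in>T. J t) x = (\<Sum>t\<in>T. group_sum h k (J t) x)"
  unfolding group_sum_def using assms
  by (intro sum.UNION_disjoint) (auto simp: disjoint_family_on_def)

text \<open>
  Additivity for two disjoint groups extends by induction to finitely many.  The base case also comes
  from additivity: taken for two empty groups, it forces their bounds to be zero.
\<close>

lemma additive_bounds_Union: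
  fixes X :: "(real ^ 'n) set" and J :: "'t \<Rightarrow> 'n set"
  assumes add: "additive_bounds X D C h" and lk: "l \<in> D" "k \<in> C l"
    and "finite T" "disjoint_family_on J T"
  shows "group_min X h k (\<Union>t\<in>T. J t) = (\<Sum>t\<in>T. group_min X h k (J t)) \<and>
    group_max X h k (\<Union>t\<in>T. J t) = (\<Sum>t\<in>T. group_max X h k (J t))"
proof -
  have two: "group_min X h k (S \<union> S') = group_min X h k S + group_min X h k S' \<and>
      group_max X h k (S \<union> S') = group_max X h k S + group_max X h k S'"
    if "S \<inter> S' = {}" for S S'
  proof -
    have "group_sum h k (S \<union> S') x = group_sum h k S x + group_sum h k S' x" for x
      using that by (simp add: group_sum_def sum.union_disjoint)
    then show ?thesis
      using add lk that by (auto simp: additive_bounds_def group_min_def group_max_def)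
  qed
  show ?thesis
    using assms(4,5)
  proof (induction rule: finite_induct)
    case empty
    then show ?case using two[of "{}" "{}"] by simp
  next
    case (insert t T)
    then have "J t \<inter> (\<Union>t\<in>T. J t) = {}" "disjoint_family_on J T"
      by (auto simp: disjoint_family_on_def)
    then show ?case using insert two by simp
  qed
qed

text \<open>
  As fine groups are non-empty, each lies in exactly one coarse group, so that the sums over the
  fine groups inside each coarse group together run over every fine group once.
\<close>

lemma p_split_refinement:
  fixes X :: "(real ^ 'n) set" and h :: "'n \<Rightarrow> 'k \<Rightarrow> real \<Rightarrow> real" and C :: "'d \<Rightarrow> 'k set"
  assumes add: "additive_bounds X D C h"
    and I: "variable_groups P I" and J: "variable_groups Q J"
    and refines: "\<And>t. t \<in> {1..Q} \<Longrightarrow> \<exists>s\<in>{1..P}. J t \<subseteq> I s"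
  shows "fst ` p_split X D C h b Q J L \<subseteq> fst ` p_split X D C h b P I L"
proof
  fix x assume "x \<in> fst ` p_split X D C h b Q J L"
  then obtain \<alpha> \<nu> lam where p: "(x, \<alpha>, \<nu>, lam) \<in> p_split X D C h b Q J L" by auto
  define T where "T s = {t \<in> {1..Q}. J t \<subseteq> I s}" for s
  have finT: "finite (T s)" for s by (simp add: T_def)
  have I_disj: "s = s'" if "s \<in> {1..P}" "s' \<in> {1..P}" "i \<in> I s" "i \<in> I s'" for s s' i
    using I that unfolding variable_groups_def disjoint_family_on_def by blast
  have T_disj: "T s \<inter> T s' = {}" if s: "s \<in> {1..P}" "s' \<in> {1..P}" "s \<noteq> s'" for s s'
  proof (rule ccontr)
    assume "T s \<inter> T s' \<noteq> {}"
    then obtain t where t: "t \<in> {1..Q}" "J t \<subseteq> I s" "J t \<subseteq> I s'" by (auto simp: T_def)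
    then obtain i where "i \<in> J t" using J unfolding variable_groups_def by blast
    then show False using I_disj[OF s(1,2), of i] t s(3) by blast
  qed
  have UT: "(\<Union>s\<in>{1..P}. T s) = {1..Q}"
    using refines by (auto simp: T_def)
  have UJ: "(\<Union>t\<in>T s. J t) = I s" if s: "s \<in> {1..P}" for s
  proof
    show "(\<Union>t\<in>T s. J t) \<subseteq> I s" by (auto simp: T_def)
    show "I s \<subseteq> (\<Union>t\<in>T s. J t)"
    proof
      fix i assume i: "i \<in> I s"
      obtain t where t: "t \<in> {1..Q}" "i \<in> J t" using J unfolding variable_groups_def by blast
      obtain s' where s': "s' \<in> {1..P}" "J t \<subseteq> I s'" using refines[OF t(1)] by blast
      have "s' = s" using I_disj[OF s'(1) s, of i] s' t i by blast
      then show "i \<in> (\<Union>t\<in>T s. J t)" using t s' by (auto simp: T_def)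
    qed
  qed
  have J_disj: "disjoint_family_on J (T s)" for s
    using J by (auto simp: variable_groups_def disjoint_family_on_def T_def)
  define \<alpha>' where "\<alpha>' l k s = (\<Sum>t\<in>T s. \<alpha> l k t)" for l k s
  define \<nu>' where "\<nu>' l k s d = (\<Sum>t\<in>T s. \<nu> l k t d)" for l k s d
  have "(\<Sum>s=1..P. \<nu>' l k s l) \<le> b l k * lam l" if "l \<in> D" "k \<in> C l" for l k
  proof -
    have "(\<Sum>s=1..P. \<nu>' l k s l) = (\<Sum>t\<in>(\<Union>s\<in>{1..P}. T s). \<nu> l k t l)"
      unfolding \<nu>'_def by (rule sum.UNION_disjoint[symmetric]) (use finT T_disj in blast)+
    also have "\<dots> = (\<Sum>t=1..Q. \<nu> l k t l)" by (simp only: UT)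
    finally show ?thesis using p that by (simp add: p_split_def)
  qed
  moreover have "\<alpha>' l k s = (\<Sum>d\<in>D. \<nu>' l k s d) \<and>
      (\<forall>d\<in>D. group_min X h k (I s) * lam d \<le> \<nu>' l k s d \<and> \<nu>' l k s d \<le> group_max X h k (I s) * lam d) \<and>
      group_sum h k (I s) x \<le> \<alpha>' l k s"
    if lk: "l \<in> D" "k \<in> C l" and s: "s \<in> {1..P}" for l k s
  proof -
    have fine: "\<alpha> l k t = (\<Sum>d\<in>D. \<nu> l k t d)" "group_sum h k (J t) x \<le> \<alpha> l k t"
      "\<And>d. d \<in> D \<Longrightarrow> group_min X h k (J t) * lam d \<le> \<nu> l k t d"
      "\<And>d. d \<in> D \<Longrightarrow> \<nu> l k t d \<le> group_max X h k (J t) * lam d" if "t \<in> T s" for t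
      using p lk that unfolding p_split_def T_def by blast+
    have "group_sum h k (I s) x = (\<Sum>t\<in>T s. group_sum h k (J t) x)"
      using group_sum_Union[OF finT J_disj] UJ[OF s] by metis
    also have "\<dots> \<le> \<alpha>' l k s"
      unfolding \<alpha>'_def by (intro sum_mono fine)
    finally have "group_sum h k (I s) x \<le> \<alpha>' l k s" .
    moreover have min: "group_min X h k (I s) = (\<Sum>t\<in>T s. group_min X h k (J t))"
      and max: "group_max X h k (I s) = (\<Sum>t\<in>T s. group_max X h k (J t))"
      using additive_bounds_Union[OF add lk finT J_disj] UJ[OF s] by metis+
    have "group_min X h k (I s) * lam d \<le> \<nu>' l k s d \<and> \<nu>' l k s d \<le> group_max X h k (I s) * lam d"
      if "d \<in> D" for d
      unfolding min max \<nu>'_def sum_distrib_right by (intro conjI sum_mono fine that)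
    moreover have "\<alpha>' l k s = (\<Sum>d\<in>D. \<nu>' l k s d)"
      unfolding \<alpha>'_def \<nu>'_def by (subst sum.swap) (simp add: fine(1))
    ultimately show ?thesis by blast
  qed
  ultimately have "(x, \<alpha>', \<nu>', lam) \<in> p_split X D C h b P I L"
    using p unfolding p_split_def mem_Collect_eq case_prod_conv by blast
  then show "x \<in> fst ` p_split X D C h b P I L" by force
qed

lemma splits_one_group_refines:
  assumes "splits_one_group P I J" "t \<in> {1..P + 1}"
  shows "\<exists>s\<in>{1..P}. J t \<subseteq> I s"
proof -
  obtain s A B where s: "s \<in> {1..P}" "A \<union> B = I s" "J ` {1..P + 1} = I ` ({1..P} - {s}) \<union> {A, B}"
    using assms(1) unfolding splits_one_group_def by (elim bexE exE conjE)
  have "J t \<in> I ` ({1..P} - {s}) \<union> {A, B}"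
    using imageI[OF assms(2), of J] unfolding s(3) .
  then consider s' where "s' \<in> {1..P}" "J t = I s'" | "J t \<subseteq> I s"
    unfolding s(2)[symmetric] by fast
  then show ?thesis
    by cases (use s(1) in auto)
qed

section \<open>Comparison of the relaxations\<close>

theorem theorem4:
  fixes X :: "(real ^ 'n) set"
    and D :: "'d set"
    and C :: "'d \<Rightarrow> 'k set"
    and h :: "'n \<Rightarrow> 'k \<Rightarrow> real \<Rightarrow> real"
    and b :: "'d \<Rightarrow> 'k \<Rightarrow> real"
  assumes "convex X" and "compact X"
    and "finite D" and "\<And>l. l \<in> D \<Longrightarrow> finite (C l)"
    and "\<And>l k i. l \<in> D \<Longrightarrow> k \<in> C l \<Longrightarrow> convex_on UNIV (h i k)"
    and "\<And>l k. l \<in> D \<Longrightarrow> k \<in> C l \<Longrightarrow> bounded (constr_fun h k ` X)"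
    and "\<And>l. l \<in> D \<Longrightarrow> {x \<in> X. \<forall>k\<in>C l. constr_fun h k x \<le> b l k} \<noteq> {}"
  shows "(\<forall>I. variable_groups 1 I \<longrightarrow>
            fst ` p_split X D C h b 1 I {0..1} = fst ` big_M X D C h b {0..1}) \<and>
         (additive_bounds X D C h \<longrightarrow>
            (\<forall>P I J. variable_groups P I \<longrightarrow> variable_groups (P + 1) J \<longrightarrow> splits_one_group P I J \<longrightarrow>
               fst ` p_split X D C h b (P + 1) J {0..1} \<subseteq> fst ` p_split X D C h b P I {0..1}))"
proof (intro conjI allI impI)
  fix I :: "nat \<Rightarrow> 'n set" assume "variable_groups 1 I"
  then have "I 1 = UNIV" by (simp add: variable_groups_def)
  then show "fst ` p_split X D C h b 1 I {0..1} = fst ` big_M X D C h b {0..1}"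
    by (intro one_split_projection_eq_big_M assms(2,3,5,7))
next
  fix P and I J :: "nat \<Rightarrow> 'n set"
  assume "additive_bounds X D C h" "variable_groups P I" "variable_groups (P + 1) J"
    "splits_one_group P I J"
  then show "fst ` p_split X D C h b (P + 1) J {0..1} \<subseteq> fst ` p_split X D C h b P I {0..1}"
    by (intro p_split_refinement splits_one_group_refines)
qed

end
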